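(* For every integer $n\ge 1$ and every integer $k\ge 0$, the number of partitions $\pi$ of $n$ with nonnegative crank, $c(\pi)\ge 0$, and having exactly $k$ parts (counted with multiplicity) that are not equal to $1$, is equal to the number of partitions $\pi$ of $n$ with odd $\operatorname{mex}(\pi)$ and having exactly $k$ parts (counted with multiplicity) that are not equal to $1$.
   Context: A partition of $n$ is a finite multiset of positive integers (its parts) with sum $n$. For a partition $\pi$ of $n\ge 1$, let $\omega(\pi)$ be the number of parts of $\pi$ equal to $1$, let $\eta(\pi)$ be the number of parts of $\pi$ (counted with multiplicity) that are strictly greater than $\omega(\pi)$, and let $\lambda_1$ be the largest part of $\pi$. The crank of $\pi$ is $$c(\pi)=\begin{cases}\lambda_1, & \text{if } \omega(\pi)=0,\\ \eta(\pi)-\omega(\pi), & \text{if } \omega(\pi)>0.\end{cases}$$ The mex of $\pi$, denoted $\operatorname{mex}(\pi)$, is the least positive integer that is not a part of $\pi$. *)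

theory Defs
  imports "HOL-Library.Multiset"
begin

definition is_partition :: "nat multiset \<Rightarrow> nat \<Rightarrow> bool" where
  "is_partition \<pi> n \<longleftrightarrow> (\<forall>p \<in># \<pi>. 0 < p) \<and> sum_mset \<pi> = n"

definition num_ones :: "nat multiset \<Rightarrow> nat" where
  "num_ones \<pi> = count \<pi> 1"

definition num_parts_above_ones :: "nat multiset \<Rightarrow> nat" where
  "num_parts_above_ones \<pi> = size {# p \<in># \<pi>. p > num_ones \<pi> #}"

text \<open>
  The value is an integer, since the crank may be negative. It is meaningful for nonempty
  multisets only: \<^term>\<open>Max {}\<close> is unspecified.
\<close>
definition crank :: "nat multiset \<Rightarrow> int" where
  "crank \<pi> =
    (if num_ones \<pi> = 0 then int (Max (set_mset \<pi>))
     else int (num_parts_above_ones \<pi>) - int (num_ones \<pi>))"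

definition mex :: "nat multiset \<Rightarrow> nat" where
  "mex \<pi> = (LEAST m. 0 < m \<and> m \<notin># \<pi>)"

definition num_non_one_parts :: "nat multiset \<Rightarrow> nat" where
  "num_non_one_parts \<pi> = size {# p \<in># \<pi>. p \<noteq> 1 #}"

text \<open>Cardinalities of sets of partitions of a fixed number are thus genuine counts.\<close>
lemma finite_partitions: "finite {\<pi>. is_partition \<pi> n}"
proof (rule finite_subset)
  show "finite (mset ` {xs. set xs \<subseteq> {..n} \<and> length xs \<le> n})"
    by (intro finite_imageI finite_lists_length_le) simp
  show "{\<pi>. is_partition \<pi> n} \<subseteq> mset ` {xs. set xs \<subseteq> {..n} \<and> length xs \<le> n}"
  proof
    fix \<pi> :: "nat multiset"
    assume "\<pi> \<in> {\<pi>. is_partition \<pi> n}"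
    then have pos: "\<forall>p \<in># \<pi>. 0 < p" and sum: "sum_mset \<pi> = n"
      by (auto simp: is_partition_def)
    from pos have "size \<pi> \<le> sum_mset \<pi>"
      by (induction \<pi>) auto
    moreover have "p \<le> n" if "p \<in># \<pi>" for p
      using sum multi_member_split[OF that] by auto
    moreover obtain xs where "mset xs = \<pi>"
      using ex_mset by blast
    ultimately show "\<pi> \<in> mset ` {xs. set xs \<subseteq> {..n} \<and> length xs \<le> n}"
      using sum by (intro image_eqI[of _ _ xs]) auto
  qed
qed

end

theory Submission
  imports Defs
begin

text \<open>
  Call a partition \<open>\<lambda>\<^sub>1 \<ge> \<lambda>\<^sub>2 \<ge> \<dots>\<close> \<open>r\<close>-balanced if \<open>\<lambda>\<^sub>i \<noteq> i + r\<close> for all \<open>i\<close>. If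
  \<open>\<lambda>\<^sub>i = i + r\<close>, removing \<open>\<lambda>\<^sub>i\<close> and adding 1 to each of the \<open>i - 1\<close> larger parts yields an
  \<open>(r + 1)\<close>-balanced partition, and this is a bijection which lowers the sum by \<open>r + 1\<close>; for
  \<open>r \<ge> 1\<close> it lowers the number of non-one parts by 1. The partitions whose least missing part \<open>m\<close>
  above \<open>r\<close> has \<open>m - r\<close> odd obey the same recursion: in the complementary case \<open>r + 1\<close> is a part,
  and removing one copy of it leads to the same condition for \<open>r + 1\<close>. Hence both kinds are
  equinumerous for every \<open>r \<ge> 1\<close>. A variant of the first bijection, in which ones are removed
  instead of \<open>\<lambda>\<^sub>i\<close>, maps the partitions of \<open>n\<close> with negative crank onto the 1-balanced partitions
  of \<open>n - 1\<close>, while removing a one maps those with even mex onto the corresponding class for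
  \<open>r = 1\<close>.
\<close>

definition parts_above :: "nat multiset \<Rightarrow> nat \<Rightarrow> nat" where
  "parts_above M v = size {# p \<in># M. v < p #}"

text \<open>
  Since \<open>v - parts_above M v\<close> is strictly increasing in \<open>v\<close>, it either takes the value \<open>s\<close> or jumps
  over it, and a jump at \<open>v\<close> means that \<open>\<lambda>\<^sub>i = v = i + s\<close> for some \<open>i\<close>.
\<close>
definition balanced :: "nat \<Rightarrow> nat multiset \<Rightarrow> bool" where
  "balanced s M \<longleftrightarrow> (\<exists>v. s + parts_above M v = v)"

definition mex_above :: "nat \<Rightarrow> nat multiset \<Rightarrow> nat" where
  "mex_above r M = (LEAST m. r < m \<and> m \<notin># M)"

definition partitions :: "nat \<Rightarrow> nat \<Rightarrow> nat multiset set" where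
  "partitions n k = {\<pi>. is_partition \<pi> n \<and> num_non_one_parts \<pi> = k}"

text \<open>Undoes adding 1 to the larger parts. It merges the sizes \<open>Suc u\<close> and
  \<open>Suc (Suc u)\<close>, so it can be inverted only when the number of shifted parts is
  known.\<close>

definition shift_down :: "nat \<Rightarrow> nat multiset \<Rightarrow> nat multiset" where
  "shift_down u M = image_mset (\<lambda>p. if Suc u < p then p - 1 else p) M"

lemma parts_above_simps [simp]:
  "parts_above {#} v = 0"
  "parts_above (add_mset p M) v = (if v < p then Suc (parts_above M v) else parts_above M v)"
  "parts_above (M + N) v = parts_above M v + parts_above N v"
  by (auto simp: parts_above_def)

lemma parts_above_replicate_mset [simp]: "parts_above (replicate_mset c p) v = (if v < p then c else 0)"
  by (induction c) auto

lemma parts_above_antimono: "v \<le> w \<Longrightarrow> parts_above M w \<le> parts_above M v"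
  by (induction M) auto

lemma parts_above_step: "parts_above M v = parts_above M (Suc v) + count M (Suc v)"
  by (induction M) auto

lemma parts_above_le_size: "parts_above M v \<le> size M"
  by (simp add: parts_above_def size_filter_mset_lesseq)

lemma parts_above_pos_iff: "0 < parts_above M v \<longleftrightarrow> (\<exists>p \<in># M. v < p)"
  by (induction M) auto

lemma finite_partitions_restrict: "finite {\<pi> \<in> partitions n k. Q \<pi>}"
  by (rule finite_subset[OF _ finite_partitions[of n]]) (auto simp: partitions_def)

section \<open>Lowering the large parts by one\<close>

lemma shift_down_simps [simp]:
  "shift_down u {#} = {#}"
  "shift_down u (add_mset p M) = add_mset (if Suc u < p then p - 1 else p) (shift_down u M)"
  "shift_down u (M + N) = shift_down u M + shift_down u N"
  by (auto simp: shift_down_def)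

lemma parts_above_shift_down_Suc: "parts_above (shift_down u M) (Suc u) = parts_above M (Suc (Suc u))"
  by (induction M) auto

lemma parts_above_shift_down_le: "parts_above (shift_down u M) (Suc u) \<le> parts_above M (Suc u)"
  by (simp add: parts_above_shift_down_Suc parts_above_antimono)

lemma parts_above_shift_down_ge: "parts_above M (Suc u) \<le> parts_above (shift_down u M) u"
  by (induction M) auto

lemma sum_shift_down: "sum_mset (shift_down u M) + parts_above M (Suc u) = sum_mset M"
  by (induction M) auto

lemma count_shift_down:
  "count (shift_down u M) p =
    (if p < Suc u then count M p
     else if p = Suc u then count M (Suc u) + count M (Suc (Suc u))
     else count M (Suc p))"
  by (induction M) auto

text \<open>Only the two merged sizes are in doubt, and \<open>ab\<close> settles how many copies of
  \<open>Suc (Suc u)\<close> there were.\<close>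

lemma shift_down_inj:
  assumes eq: "shift_down u M = shift_down u N" and ab: "parts_above M (Suc u) = parts_above N (Suc u)"
  shows "M = N"
proof (rule multiset_eqI)
  fix p
  have c: "count (shift_down u M) q = count (shift_down u N) q" for q
    using eq by simp
  have c2: "count M (Suc (Suc u)) = count N (Suc (Suc u))"
    using ab parts_above_step[of M "Suc u"] parts_above_step[of N "Suc u"]
      parts_above_shift_down_Suc[of u M] parts_above_shift_down_Suc[of u N] eq by simp
  consider "p < Suc u" | "p = Suc u" | "p = Suc (Suc u)" | q where "p = Suc q" "Suc u < q"
    by (metis Suc_lessE less_antisym linorder_neqE_nat)
  then show "count M p = count N p"
  proof cases
    case 1 then show ?thesis using c[of p] by (simp add: count_shift_down)
  next
    case 2 then show ?thesis using c[of p] c2 by (simp add: count_shift_down)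
  next
    case 3 then show ?thesis using c2 by simp
  next
    case 4 then show ?thesis using c[of q] by (simp add: count_shift_down)
  qed
qed

lemma shift_down_surj:
  assumes "parts_above M (Suc u) \<le> t" "t \<le> parts_above M u"
  obtains N where "shift_down u N = M" "parts_above N (Suc u) = t"
proof -
  define A B where "A = {# p \<in># M. Suc u < p #}" and "B = {# p \<in># M. p < Suc u #}"
  \<comment> \<open>All of \<open>A\<close> must come from shifted parts; \<open>d\<close> copies of
    \<open>Suc u\<close> supply the missing ones, and the bounds on \<open>t\<close> ensure that
    there are enough.\<close>
  define d where "d = t - size A"
  have A: "shift_down u (image_mset Suc A) = A"
    by (auto simp: A_def shift_down_def multiset.map_comp o_def intro!: multiset.map_ident_strong)
  have B: "shift_down u B = B"
    by (auto simp: B_def shift_down_def intro!: multiset.map_ident_strong)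
  have R: "shift_down u (replicate_mset c p) = replicate_mset c (if Suc u < p then p - 1 else p)" for c p
    by (simp add: shift_down_def)
  have aA: "parts_above (image_mset Suc A) (Suc u) = size A"
    by (auto simp: A_def parts_above_def filter_mset_image_mset filter_filter_mset
        intro!: arg_cong[where f = size] filter_mset_cong)
  have aB: "parts_above B (Suc u) = 0"
    using parts_above_pos_iff[of B "Suc u"] by (auto simp: B_def)
  have sA: "size A = parts_above M (Suc u)"
    by (simp add: A_def parts_above_def)
  have d: "d \<le> count M (Suc u)" "size A + d = t"
    using assms parts_above_step[of M u] sA by (auto simp: d_def)
  have M: "M = A + replicate_mset (count M (Suc u)) (Suc u) + B"
    by (rule multiset_eqI) (auto simp: A_def B_def)
  let ?N = "image_mset Suc A + replicate_mset d (Suc (Suc u))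
    + replicate_mset (count M (Suc u) - d) (Suc u) + B"
  show ?thesis
  proof (rule that)
    have "shift_down u ?N = A + replicate_mset (count M (Suc u)) (Suc u) + B"
      using d(1) by (intro multiset_eqI) (simp add: A B R)
    then show "shift_down u ?N = M"
      using M by simp
    show "parts_above ?N (Suc u) = t"
      using d(2) by (simp add: aA aB)
  qed
qed

section \<open>Jumps and balance points\<close>

lemma not_balanced_iff:
  "\<not> balanced r M \<longleftrightarrow> (\<exists>u. r + parts_above M (Suc u) \<le> u \<and> u < r + parts_above M u)"
proof
  assume nb: "\<not> balanced r M"
  \<comment> \<open>The first \<open>v\<close> at which \<open>v - parts_above M v\<close> reaches
    \<open>r\<close>. Without balance it overshoots there, so the jump starts at the
    predecessor.\<close>
  define v where "v = (LEAST v. r + parts_above M v \<le> v)"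
  have "r + parts_above M (r + size M) \<le> r + size M"
    by (simp add: parts_above_le_size)
  then have v: "r + parts_above M v \<le> v"
    unfolding v_def by (rule LeastI)
  with nb have lt: "r + parts_above M v < v"
    by (metis balanced_def le_neq_implies_less)
  then obtain u where u: "v = Suc u"
    by (cases v) auto
  have "\<not> r + parts_above M u \<le> u"
    using not_less_Least[of u "\<lambda>v. r + parts_above M v \<le> v"] u by (simp add: v_def)
  then show "\<exists>u. r + parts_above M (Suc u) \<le> u \<and> u < r + parts_above M u"
    using lt u by (intro exI[of _ u]) auto
next
  assume "\<exists>u. r + parts_above M (Suc u) \<le> u \<and> u < r + parts_above M u"
  then obtain u where u: "r + parts_above M (Suc u) \<le> u" "u < r + parts_above M u"
    by blast
  show "\<not> balanced r M"
  proof
    assume "balanced r M"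
    then obtain w where w: "r + parts_above M w = w"
      by (auto simp: balanced_def)
    show False
      using u w parts_above_antimono[of w u M] parts_above_antimono[of "Suc u" w M]
      by (cases "w \<le> u") auto
  qed
qed

text \<open>Puts a balance point \<open>Suc u\<close> into the form suited to
  \<open>shift_down u\<close>: the number of shifted parts is \<open>u - r\<close>.\<close>

lemma balanced_Suc_iff: "balanced (Suc r) M \<longleftrightarrow> (\<exists>u. r + parts_above M (Suc u) = u)"
proof
  assume "balanced (Suc r) M"
  then obtain v where "Suc r + parts_above M v = v"
    by (auto simp: balanced_def)
  then show "\<exists>u. r + parts_above M (Suc u) = u"
    by (cases v) auto
qed (auto simp: balanced_def)

lemma balance_point_unique:
  assumes "r + parts_above M (Suc u) = u" "r + parts_above M (Suc w) = w"
  shows "u = w"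
  using assms parts_above_antimono[of "Suc u" "Suc w" M] parts_above_antimono[of "Suc w" "Suc u" M]
  by (cases u w rule: linorder_cases) auto

lemma num_non_one_parts_simps [simp]:
  "num_non_one_parts {#} = 0"
  "num_non_one_parts (add_mset p M) = (if p = 1 then num_non_one_parts M else Suc (num_non_one_parts M))"
  "num_non_one_parts (M + N) = num_non_one_parts M + num_non_one_parts N"
  by (auto simp: num_non_one_parts_def)

lemma num_non_one_parts_replicate_1 [simp]: "num_non_one_parts (replicate_mset c (Suc 0)) = 0"
  by (induction c) auto

lemma num_non_one_parts_shift_down:
  assumes "0 < u \<or> parts_above M 1 = 0"
  shows "num_non_one_parts (shift_down u M) = num_non_one_parts M"
  using assms by (induction M) (auto split: if_splits)

lemma zero_notin_shift_down_iff: "(0 \<notin># shift_down u M) \<longleftrightarrow> (0 \<notin># M)"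
  by (induction M) auto

lemma in_partitions_iff:
  "\<pi> \<in> partitions n k \<longleftrightarrow> 0 \<notin># \<pi> \<and> sum_mset \<pi> = n \<and> num_non_one_parts \<pi> = k"
  by (auto simp: partitions_def is_partition_def) (metis gr0I)

text \<open>
  A balance point is unique, so counting balanced partitions is counting pairs of a balance point
  and a partition.
\<close>
lemma card_balanced_eqI:
  assumes inj: "\<And>u M w N. \<lbrakk>r + parts_above M (Suc u) = u; r + parts_above N (Suc w) = w; h u M = h w N\<rbrakk>
      \<Longrightarrow> u = w \<and> M = N"
    and mem: "\<And>u M. \<lbrakk>r + parts_above M (Suc u) = u; M \<in> partitions m j\<rbrakk> \<Longrightarrow> h u M \<in> S"
    and surj: "\<And>\<pi>. \<pi> \<in> S \<Longrightarrow>
      \<exists>u M. r + parts_above M (Suc u) = u \<and> M \<in> partitions m j \<and> h u M = \<pi>"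
  shows "card S = card {\<pi> \<in> partitions m j. balanced (Suc r) \<pi>}"
proof -
  define T where "T = {(u, M). r + parts_above M (Suc u) = u \<and> M \<in> partitions m j}"
  have "inj_on (\<lambda>(u, M). h u M) T"
    using inj by (auto simp: T_def inj_on_def)
  moreover have "(\<lambda>(u, M). h u M) ` T = S"
  proof (intro equalityI subsetI)
    fix \<pi> assume "\<pi> \<in> S"
    with surj obtain u M where "(u, M) \<in> T" "h u M = \<pi>"
      unfolding T_def by blast
    then show "\<pi> \<in> (\<lambda>(u, M). h u M) ` T"
      by (auto intro!: image_eqI[of _ _ "(u, M)"])
  qed (use mem in \<open>auto simp: T_def\<close>)
  ultimately have "card S = card T"
    using card_image by metis
  moreover have "inj_on snd T"
    using balance_point_unique by (auto simp: T_def inj_on_def)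
  moreover have "snd ` T = {\<pi> \<in> partitions m j. balanced (Suc r) \<pi>}"
    by (auto simp: T_def balanced_Suc_iff image_iff)
  ultimately show ?thesis
    using card_image by metis
qed

text \<open>
  With the balance point \<open>Suc u = i + r\<close>, exactly \<open>i - 1\<close> parts are shifted down, and the inserted
  part becomes the \<open>i\<close>-th largest one.
\<close>
lemma card_not_balanced:
  assumes "0 < r"
  shows "card {\<pi> \<in> partitions (m + Suc r) (Suc j). \<not> balanced r \<pi>}
    = card {\<pi> \<in> partitions m j. balanced (Suc r) \<pi>}"
proof (rule card_balanced_eqI[where h = "\<lambda>u M. add_mset (Suc u) (shift_down u M)"])
  \<comment> \<open>The image jumps over \<open>r\<close> between \<open>u\<close> and
    \<open>Suc u\<close>. This shows that it is unbalanced and lets \<open>u\<close> be recovered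
    from it.\<close>
  have bounds: "r + parts_above \<pi> (Suc u) \<le> u" "u < r + parts_above \<pi> u"
    if "r + parts_above M (Suc u) = u" "\<pi> = add_mset (Suc u) (shift_down u M)" for u M \<pi>
    using that parts_above_shift_down_le[of u M] parts_above_shift_down_ge[of M u] by auto
  {
    fix u M w N
    assume u: "r + parts_above M (Suc u) = u" and w: "r + parts_above N (Suc w) = w"
      and eq: "add_mset (Suc u) (shift_down u M) = add_mset (Suc w) (shift_down w N)"
    let ?\<pi> = "add_mset (Suc u) (shift_down u M)"
    have "u = w"
      using bounds[OF u refl] bounds[OF w eq]
        parts_above_antimono[of "Suc u" w ?\<pi>] parts_above_antimono[of "Suc w" u ?\<pi>]
      by (cases u w rule: linorder_cases) auto
    with eq u w show "u = w \<and> M = N"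
      using shift_down_inj[of u M N] by auto
  next
    fix u M
    assume u: "r + parts_above M (Suc u) = u" and M: "M \<in> partitions m j"
    \<comment> \<open>For positive \<open>u\<close> no shifted part becomes 1 and the inserted part
      is not 1.\<close>
    have "0 < u" using u assms by simp
    with M u sum_shift_down[of u M] have "add_mset (Suc u) (shift_down u M) \<in> partitions (m + Suc r) (Suc j)"
      by (auto simp: in_partitions_iff zero_notin_shift_down_iff num_non_one_parts_shift_down)
    moreover have "\<not> balanced r (add_mset (Suc u) (shift_down u M))"
      using bounds[OF u refl] not_balanced_iff by blast
    ultimately show "add_mset (Suc u) (shift_down u M)
        \<in> {\<pi> \<in> partitions (m + Suc r) (Suc j). \<not> balanced r \<pi>}"
      by simp
  next
    fix \<pi>
    assume "\<pi> \<in> {\<pi> \<in> partitions (m + Suc r) (Suc j). \<not> balanced r \<pi>}"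
    then obtain u where u: "r + parts_above \<pi> (Suc u) \<le> u" "u < r + parts_above \<pi> u"
      and \<pi>: "\<pi> \<in> partitions (m + Suc r) (Suc j)"
      using not_balanced_iff by auto
    have "0 < count \<pi> (Suc u)"
      using u parts_above_step[of \<pi> u] by linarith
    then obtain \<rho> where \<rho>: "\<pi> = add_mset (Suc u) \<rho>"
      by (metis count_greater_zero_iff mset_add)
    \<comment> \<open>The balance equation forces the number \<open>u - r\<close> of shifted
      parts.\<close>
    obtain M where M: "shift_down u M = \<rho>" "parts_above M (Suc u) = u - r"
      by (rule shift_down_surj[of \<rho> u "u - r"]) (use u \<rho> in auto)
    have "0 < u" "r + parts_above M (Suc u) = u"
      using u M assms by auto
    moreover have "M \<in> partitions m j"
      using \<pi> \<open>0 < u\<close> M u(1) sum_shift_down[of u M] num_non_one_parts_shift_down[of u M]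
        zero_notin_shift_down_iff[of u M]
      by (auto simp: in_partitions_iff \<rho>)
    ultimately show "\<exists>u M. r + parts_above M (Suc u) = u \<and> M \<in> partitions m j
        \<and> add_mset (Suc u) (shift_down u M) = \<pi>"
      using M \<rho> by blast
  }
qed

section \<open>Partitions with negative crank\<close>

lemma crank_neg_iff: "crank \<pi> < 0 \<longleftrightarrow> parts_above \<pi> (count \<pi> 1) < count \<pi> 1"
  \<comment> \<open>Without ones both sides are false: the crank is then a cast natural number,
    whatever \<open>Max {}\<close> may be.\<close>
  by (simp add: crank_def num_ones_def num_parts_above_ones_def parts_above_def)

text \<open>The same map, except that ones are inserted instead of a single part of that size.\<close>
lemma card_crank_neg:
  "card {\<pi> \<in> partitions (Suc m) k. crank \<pi> < 0} = card {\<pi> \<in> partitions m k. balanced (Suc 0) \<pi>}"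
proof (rule card_balanced_eqI[where h = "\<lambda>u M. shift_down u M + replicate_mset (Suc u) 1"])
  \<comment> \<open>These make \<open>u\<close> the least number with
    \<open>parts_above \<pi> (Suc u) \<le> u\<close>, hence determined by
    \<open>\<pi>\<close>.\<close>
  have bounds: "parts_above \<pi> (Suc u) \<le> u" "u \<le> parts_above \<pi> u"
    if "0 + parts_above M (Suc u) = u" "\<pi> = shift_down u M + replicate_mset (Suc u) 1" for u M \<pi>
    using that parts_above_shift_down_le[of u M] parts_above_shift_down_ge[of M u] by auto
  {
    fix u M w N
    assume u: "0 + parts_above M (Suc u) = u" and w: "0 + parts_above N (Suc w) = w"
      and eq: "shift_down u M + replicate_mset (Suc u) 1 = shift_down w N + replicate_mset (Suc w) 1"
    let ?\<pi> = "shift_down u M + replicate_mset (Suc u) 1"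
    have "u = w"
      using bounds[OF u refl] bounds[OF w eq]
        parts_above_antimono[of "Suc u" w ?\<pi>] parts_above_antimono[of "Suc w" u ?\<pi>]
      by (cases u w rule: linorder_cases) auto
    with eq u w show "u = w \<and> M = N"
      using shift_down_inj[of u M N] by auto
  next
    fix u M
    assume u: "0 + parts_above M (Suc u) = u" and M: "M \<in> partitions m k"
    let ?\<pi> = "shift_down u M + replicate_mset (Suc u) 1"
    \<comment> \<open>For \<open>u = 0\<close> the balance equation excludes parts above 1, so no 2
      is shifted to a one.\<close>
    have "0 < u \<or> parts_above M 1 = 0" using u by (cases u) auto
    with M u sum_shift_down[of u M] have "?\<pi> \<in> partitions (Suc m) k"
      by (auto simp: in_partitions_iff zero_notin_shift_down_iff num_non_one_parts_shift_down)
    moreover have "Suc u \<le> count ?\<pi> 1"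
      by simp
    then have "parts_above ?\<pi> (count ?\<pi> 1) < count ?\<pi> 1"
      using bounds(1)[OF u refl] parts_above_antimono[of "Suc u" "count ?\<pi> 1" ?\<pi>] by linarith
    ultimately show "?\<pi> \<in> {\<pi> \<in> partitions (Suc m) k. crank \<pi> < 0}"
      by (simp only: crank_neg_iff mem_Collect_eq)
  next
    fix \<pi>
    assume "\<pi> \<in> {\<pi> \<in> partitions (Suc m) k. crank \<pi> < 0}"
    then have \<pi>: "\<pi> \<in> partitions (Suc m) k" and cr: "parts_above \<pi> (count \<pi> 1) < count \<pi> 1"
      by (simp_all add: crank_neg_iff)
    \<comment> \<open>The choice forced by \<open>bounds\<close>; minimality also gives
      \<open>u \<le> c\<close>, so that \<open>Suc u\<close> ones can be removed.\<close>
    define u where "u = (LEAST u. parts_above \<pi> (Suc u) \<le> u)"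
    obtain c where c: "count \<pi> 1 = Suc c"
      using cr by (cases "count \<pi> 1") auto
    then have c_le: "parts_above \<pi> (Suc c) \<le> c"
      using cr by simp
    then have u: "parts_above \<pi> (Suc u) \<le> u" and "u \<le> c"
      unfolding u_def by (rule LeastI, rule Least_le)
    have u': "u \<le> parts_above \<pi> u"
    proof (cases u)
      case (Suc w)
      then have "\<not> parts_above \<pi> (Suc w) \<le> w"
        using not_less_Least[of w "\<lambda>u. parts_above \<pi> (Suc u) \<le> u"] by (simp add: u_def)
      with Suc show ?thesis by simp
    qed simp
    obtain \<rho> where \<rho>: "\<pi> = \<rho> + replicate_mset (Suc u) 1"
      using c \<open>u \<le> c\<close> by (metis Suc_le_mono count_le_replicate_mset_subset_eq subset_mset.diff_add)
    obtain M where M: "shift_down u M = \<rho>" "parts_above M (Suc u) = u"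
      by (rule shift_down_surj[of \<rho> u u]) (use u u' in \<open>auto simp: \<rho> split: if_splits\<close>)
    have "0 < u \<or> parts_above M 1 = 0"
      using M(2) by (cases u) auto
    then have "M \<in> partitions m k"
      using \<pi> M sum_shift_down[of u M] num_non_one_parts_shift_down[of u M]
        zero_notin_shift_down_iff[of u M]
      by (auto simp: in_partitions_iff \<rho>)
    then show "\<exists>u M. 0 + parts_above M (Suc u) = u \<and> M \<in> partitions m k
        \<and> shift_down u M + replicate_mset (Suc u) 1 = \<pi>"
      using M \<rho> by (metis add_0)
  }
qed

section \<open>Parity of the least missing part\<close>

lemma mex_above_notin: "Suc r \<notin># M \<Longrightarrow> mex_above r M = Suc r"
  unfolding mex_above_def by (rule Least_equality) auto

lemma mex_above_in: "Suc r \<in># M \<Longrightarrow> mex_above r M = mex_above (Suc r) M"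
  unfolding mex_above_def by (rule arg_cong[where f = Least]) (auto simp: fun_eq_iff, metis Suc_lessI)

lemma mex_above_add: "mex_above (Suc r) (add_mset (Suc r) M) = mex_above (Suc r) M"
  unfolding mex_above_def by (rule arg_cong[where f = Least]) auto

text \<open>If \<open>Suc r\<close> is missing, the sum is \<open>2 * r + 1\<close>. Adding
  \<open>r\<close> has the same parity as subtracting it and avoids truncation.\<close>

lemma even_mex_above_imp: "even (mex_above r M + r) \<Longrightarrow> Suc r \<in># M"
  using mex_above_notin[of r M] by (cases "Suc r \<in># M") auto

text \<open>Removing one copy of \<open>Suc r\<close> leaves \<open>mex_above (Suc r)\<close>
  unchanged, while the added offset grows by one and flips the parity. For \<open>r = 0\<close> the
  removed part is a one, so the number of non-one parts stays.\<close>

lemma card_even_mex_above: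
  "card {\<pi> \<in> partitions (m + Suc r) (if r = 0 then j else Suc j). even (mex_above r \<pi> + r)}
    = card {\<pi> \<in> partitions m j. odd (mex_above (Suc r) \<pi> + Suc r)}"
proof (rule sym, rule card_bij_eq[where f = "add_mset (Suc r)" and g = "\<lambda>\<pi>. \<pi> - {#Suc r#}"])
  show "add_mset (Suc r) ` {\<pi> \<in> partitions m j. odd (mex_above (Suc r) \<pi> + Suc r)}
    \<subseteq> {\<pi> \<in> partitions (m + Suc r) (if r = 0 then j else Suc j). even (mex_above r \<pi> + r)}"
    by (auto simp: in_partitions_iff mex_above_in mex_above_add)
  show "(\<lambda>\<pi>. \<pi> - {#Suc r#})
      ` {\<pi> \<in> partitions (m + Suc r) (if r = 0 then j else Suc j). even (mex_above r \<pi> + r)}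
    \<subseteq> {\<pi> \<in> partitions m j. odd (mex_above (Suc r) \<pi> + Suc r)}"
  proof (intro subsetI, elim imageE)
    fix \<sigma> \<pi>
    assume \<sigma>: "\<sigma> = \<pi> - {#Suc r#}" and
      \<pi>: "\<pi> \<in> {\<pi> \<in> partitions (m + Suc r) (if r = 0 then j else Suc j). even (mex_above r \<pi> + r)}"
    then have "\<pi> = add_mset (Suc r) \<sigma>"
      using even_mex_above_imp by auto
    then show "\<sigma> \<in> {\<pi> \<in> partitions m j. odd (mex_above (Suc r) \<pi> + Suc r)}"
      using \<pi> by (auto simp: in_partitions_iff mex_above_in mex_above_add split: if_splits)
  qed
  show "inj_on (\<lambda>\<pi>. \<pi> - {#Suc r#})
      {\<pi> \<in> partitions (m + Suc r) (if r = 0 then j else Suc j). even (mex_above r \<pi> + r)}"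
    by (rule inj_onI, elim CollectE conjE) (metis even_mex_above_imp insert_DiffM)
qed (auto intro: finite_partitions_restrict inj_onI)

section \<open>Comparing the two classes\<close>

lemma card_complements_eq:
  assumes "card {\<pi> \<in> partitions n k. \<not> P \<pi>} = card {\<pi> \<in> partitions n k. \<not> Q \<pi>}"
  shows "card {\<pi> \<in> partitions n k. P \<pi>} = card {\<pi> \<in> partitions n k. Q \<pi>}"
proof -
  have "card {\<pi> \<in> partitions n k. R \<pi>} + card {\<pi> \<in> partitions n k. \<not> R \<pi>} = card (partitions n k)" for R
    using card_Un_disjoint[of "{\<pi> \<in> partitions n k. R \<pi>}" "{\<pi> \<in> partitions n k. \<not> R \<pi>}"]
      finite_partitions_restrict
    by (simp add: disjoint_iff flip: Collect_disj_eq conj_disj_distribL)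
  from this[of P] this[of Q] assms show ?thesis
    by linarith
qed

text \<open>A jump at \<open>u\<close> has \<open>r \<le> u\<close> and some part above
  \<open>u\<close>.\<close>

lemma unbalanced_has_large_part: "\<not> balanced r M \<Longrightarrow> \<exists>p \<in># M. r < p"
  unfolding not_balanced_iff using parts_above_pos_iff
  by (metis add.right_neutral add_leE gr0I le_less_trans not_less)

lemma large_part_bounds:
  assumes "\<pi> \<in> partitions n k" "p \<in># \<pi>" "0 < r" "r < p"
  shows "Suc r \<le> n \<and> 0 < k"
  using assms by (auto dest!: multi_member_split simp: in_partitions_iff)

lemma card_balanced_eq_card_odd_mex_above:
  assumes "0 < r"
  shows "card {\<pi> \<in> partitions n k. balanced r \<pi>}
    = card {\<pi> \<in> partitions n k. odd (mex_above r \<pi> + r)}"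
  using assms
proof (induction k arbitrary: n r rule: less_induct)
  case (less k n r)
  show ?case
  proof (cases "Suc r \<le> n \<and> 0 < k")
    case True
    then obtain m j where n: "n = m + Suc r" and k: "k = Suc j"
      by (metis add.commute le_Suc_ex gr0_implies_Suc)
    have "card {\<pi> \<in> partitions n k. \<not> balanced r \<pi>}
        = card {\<pi> \<in> partitions m j. balanced (Suc r) \<pi>}"
      unfolding n k by (rule card_not_balanced[OF less.prems])
    also have "\<dots> = card {\<pi> \<in> partitions m j. odd (mex_above (Suc r) \<pi> + Suc r)}"
      by (rule less.IH) (simp_all add: k)
    also have "\<dots> = card {\<pi> \<in> partitions n k. \<not> odd (mex_above r \<pi> + r)}"
      using card_even_mex_above[of m r j] less.prems by (simp add: n k)
    finally show ?thesis
      by (rule card_complements_eq)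
  next
    \<comment> \<open>No part can exceed \<open>r\<close>, so both classes are all of
      \<open>partitions n k\<close>.\<close>
    case False
    have "balanced r \<pi>" "odd (mex_above r \<pi> + r)" if "\<pi> \<in> partitions n k" for \<pi>
      using False large_part_bounds[OF that _ less.prems] unbalanced_has_large_part[of r \<pi>]
        even_mex_above_imp[of r \<pi>]
      by blast+
    then show ?thesis
      by (intro arg_cong[where f = card]) auto
  qed
qed

theorem theorem2:
  fixes n k :: nat
  assumes "n \<ge> 1"
  shows "card {\<pi>. is_partition \<pi> n \<and> crank \<pi> \<ge> 0 \<and> num_non_one_parts \<pi> = k}
       = card {\<pi>. is_partition \<pi> n \<and> odd (mex \<pi>) \<and> num_non_one_parts \<pi> = k}"
proof -
  obtain m where n: "n = Suc m"
    using assms by (cases n) auto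
  have "card {\<pi> \<in> partitions n k. \<not> 0 \<le> crank \<pi>}
      = card {\<pi> \<in> partitions m k. balanced (Suc 0) \<pi>}"
    using card_crank_neg by (simp add: n not_le)
  also have "\<dots> = card {\<pi> \<in> partitions m k. odd (mex_above (Suc 0) \<pi> + Suc 0)}"
    by (rule card_balanced_eq_card_odd_mex_above) simp
  \<comment> \<open>The case \<open>r = 0\<close>, as \<open>mex\<close> is
    \<open>mex_above 0\<close>.\<close>
  also have "\<dots> = card {\<pi> \<in> partitions n k. \<not> odd (mex \<pi>)}"
    using card_even_mex_above[of m 0 k] by (simp add: n mex_def mex_above_def)
  finally have "card {\<pi> \<in> partitions n k. 0 \<le> crank \<pi>} = card {\<pi> \<in> partitions n k. odd (mex \<pi>)}"
    by (rule card_complements_eq)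
  then show ?thesis
    by (simp add: partitions_def conj_ac)
qed

end
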